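(* Let $N$, $n$ and $k$ be non-negative integers. The number of partitions of $n$ into exactly $k$ parts, all of which are odd and $\le 2N-2k+1$, is equal to the number of partitions of $n$ into distinct parts $\leq N$ with the alternating sum of parts being equal to $k$.
   Context: A partition $\pi=(\lambda_1,\lambda_2,\dots,\lambda_m)$ is a finite non-increasing sequence of positive integers (its parts); it is a partition of $n$ if the parts sum to $n$; the empty sequence is the unique partition of $0$. The alternating sum of parts of $\pi$ is $\gamma(\pi)=\lambda_1-\lambda_2+\lambda_3-\lambda_4+\dots+(-1)^{m+1}\lambda_m$ (equal to $0$ for the empty partition). *)

theory Defs
  imports Main
begin

definition is_partition :: "nat list \<Rightarrow> bool" where
  "is_partition p \<longleftrightarrow> sorted_wrt (\<ge>) p \<and> (\<forall>x\<in>set p. 0 < x)"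

definition partitions_of :: "nat \<Rightarrow> nat list set" where
  "partitions_of n = {p. is_partition p \<and> sum_list p = n}"

text \<open>Indices start at 0, so the largest part \<open>p ! 0\<close> gets the sign \<open>+\<close>.
  The values are integers to avoid truncated subtraction.\<close>

definition alt_sum :: "nat list \<Rightarrow> int" where
  "alt_sum p = (\<Sum>i<length p. (- 1) ^ i * int (p ! i))"

text \<open>Finiteness, so that \<open>card\<close> really counts subsets of \<open>partitions_of n\<close>.\<close>

lemma finite_partitions_of: "finite (partitions_of n)"
proof (rule finite_subset)
  have len: "length p \<le> sum_list p" if "\<forall>x\<in>set p. 0 < x" for p :: "nat list"
    using that by (induction p) auto
  show "partitions_of n \<subseteq> {p. set p \<subseteq> {..n} \<and> length p \<le> n}"
    using len by (auto simp: partitions_of_def is_partition_def member_le_sum_list)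
  show "finite {p. set p \<subseteq> {..n} \<and> length p \<le> n}"
    by (rule finite_lists_length_le) simp
qed

end

theory Submission
  imports Defs "HOL-Computational_Algebra.Polynomial"
begin

text \<open>
  Partitions into exactly \<open>b\<close> odd parts, each at most \<open>2a + 1\<close>, have the generating function
  \<open>L a b = q^b * binom(a + b, b)\<close>, with a Gaussian binomial coefficient in base \<open>q\<^sup>2\<close>. Looking at
  whether the largest part is \<open>2a + 1\<close>, or whether the smallest part is \<open>1\<close>, gives the two Pascal
  recurrences, and these together yield the symmetry \<open>q^b * L b a = q^a * L a b\<close>. Let \<open>D N k\<close> be
  the generating function of the partitions into distinct parts \<open>\<le> N\<close> with alternating sum \<open>k\<close>.
  Removing a part \<open>N\<close> replaces the alternating sum \<open>k\<close> of the partition by \<open>N - k\<close>, so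
  \<open>D N k = D (N - 1) k + q^N * D (N - 1) (N - k)\<close>. By the symmetry this is the first Pascal
  recurrence, whence \<open>D (a + b) b = L a b\<close> by induction.
\<close>

text \<open>Natural coefficients let each coefficient be a cardinality. A polynomial suffices
  because only finite sets matter; an infinite set would give 0.\<close>

definition gen_fun :: "nat list set \<Rightarrow> nat poly" where
  "gen_fun S = (\<Sum>p\<in>S. monom 1 (sum_list p))"

lemma coeff_gen_fun:
  assumes "finite S"
  shows "coeff (gen_fun S) n = card {p \<in> S. sum_list p = n}"
proof -
  have "coeff (gen_fun S) n = (\<Sum>p\<in>S. if sum_list p = n then 1 else 0)"
    by (simp add: gen_fun_def coeff_sum if_distrib cong: if_cong)
  also have "\<dots> = card {p \<in> S. sum_list p = n}"
    using assms by (simp add: sum.If_cases Int_def)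
  finally show ?thesis .
qed

lemma gen_fun_empty [simp]: "gen_fun {} = 0"
  by (simp add: gen_fun_def)

lemma gen_fun_singleton [simp]: "gen_fun {p} = monom 1 (sum_list p)"
  by (simp add: gen_fun_def)

lemma gen_fun_Un_disjoint:
  "finite A \<Longrightarrow> finite B \<Longrightarrow> A \<inter> B = {} \<Longrightarrow> gen_fun (A \<union> B) = gen_fun A + gen_fun B"
  by (simp add: gen_fun_def sum.union_disjoint)

lemma gen_fun_image:
  assumes "inj_on f A" "\<And>p. p \<in> A \<Longrightarrow> sum_list (f p) = c + sum_list p"
  shows "gen_fun (f ` A) = monom 1 c * gen_fun A"
  using assms by (simp add: gen_fun_def sum.reindex sum_distrib_left mult_monom)

section \<open>Partitions into odd parts\<close>

text \<open>The sum is left free for \<open>gen_fun\<close> to record. Oddness already makes the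
  parts positive.\<close>

definition odd_partitions :: "nat \<Rightarrow> nat \<Rightarrow> nat list set" where
  "odd_partitions a b =
    {p. sorted_wrt (\<ge>) p \<and> length p = b \<and> (\<forall>x\<in>set p. odd x \<and> x \<le> 2 * a + 1)}"

lemma finite_odd_partitions [simp]: "finite (odd_partitions a b)"
  by (rule finite_subset[OF _ finite_lists_length_eq[of "{..2 * a + 1}" b]])
    (auto simp: odd_partitions_def)

lemma odd_partitions_0_right [simp]: "odd_partitions a 0 = {[]}"
  by (auto simp: odd_partitions_def)

lemma odd_partitions_0_left: "odd_partitions 0 b = {replicate b 1}"
proof -
  have "(odd x \<and> x \<le> 2 * 0 + 1) \<longleftrightarrow> x = 1" for x :: nat
    by (auto simp: le_Suc_eq)
  then have "odd_partitions 0 b = {p. sorted_wrt (\<ge>) p \<and> length p = b \<and> (\<forall>x\<in>set p. x = 1)}"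
    unfolding odd_partitions_def by presburger
  also have "\<dots> = {replicate b 1}"
    by (auto simp del: One_nat_def simp: sorted_wrt_iff_nth_less intro: replicate_eqI)
  finally show ?thesis .
qed

lemma gen_fun_odd_partitions_0_left [simp]: "gen_fun (odd_partitions 0 b) = monom 1 b"
  by (simp add: odd_partitions_0_left sum_list_replicate)

text \<open>The head is the largest part; if it is not the bound \<open>2 * a + 3\<close>, parity
  forces it down to at most \<open>2 * a + 1\<close>.\<close>

lemma odd_partitions_split_max:
  "odd_partitions (Suc a) (Suc b) =
     odd_partitions a (Suc b) \<union> Cons (2 * a + 3) ` odd_partitions (Suc a) b"
proof (intro equalityI subsetI)
  fix p assume p: "p \<in> odd_partitions (Suc a) (Suc b)"
  then obtain x r where r: "p = x # r"
    by (cases p) (auto simp: odd_partitions_def)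
  show "p \<in> odd_partitions a (Suc b) \<union> Cons (2 * a + 3) ` odd_partitions (Suc a) b"
  proof (cases "x = 2 * a + 3")
    case True
    then show ?thesis using p r by (auto simp: odd_partitions_def)
  next
    case False
    moreover have "odd x" "x \<le> 2 * a + 3" using p r by (auto simp: odd_partitions_def)
    ultimately have "x \<le> 2 * a + 1" by presburger
    then have "p \<in> odd_partitions a (Suc b)" using p r
      by (fastforce simp: odd_partitions_def)
    then show ?thesis by blast
  qed
qed (fastforce simp: odd_partitions_def)

text \<open>The last entry is the smallest part. If it is not 1, every part can be lowered by 2,
  which keeps parity and lowers the bound by 2.\<close>

lemma odd_partitions_split_min:
  "odd_partitions (Suc a) (Suc b) =
     (\<lambda>p. p @ [1]) ` odd_partitions (Suc a) b \<union> map (\<lambda>x. x + 2) ` odd_partitions a (Suc b)"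
proof (intro equalityI subsetI)
  fix p assume p: "p \<in> odd_partitions (Suc a) (Suc b)"
  then obtain x r where r: "p = r @ [x]"
    by (cases p rule: rev_exhaust) (auto simp: odd_partitions_def)
  show "p \<in> (\<lambda>p. p @ [1]) ` odd_partitions (Suc a) b
          \<union> map (\<lambda>x. x + 2) ` odd_partitions a (Suc b)"
  proof (cases "x = 1")
    case True
    then show ?thesis using p r by (auto simp: odd_partitions_def sorted_wrt_append)
  next
    case False
    moreover have "odd x" using p r by (auto simp: odd_partitions_def)
    ultimately have "x \<ge> 2" by presburger
    then have ge: "\<forall>y\<in>set p. y \<ge> 2"
      using p r by (fastforce simp: odd_partitions_def sorted_wrt_append)
    define s where "s = map (\<lambda>x. x - 2) p"
    have "p = map (\<lambda>x. x + 2) s"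
      using ge by (auto simp: s_def intro!: map_idI[symmetric])
    moreover from this have "s \<in> odd_partitions a (Suc b)"
      using p by (auto simp: odd_partitions_def sorted_wrt_map)
    ultimately show ?thesis by blast
  qed
next
  fix p assume "p \<in> (\<lambda>p. p @ [1]) ` odd_partitions (Suc a) b
          \<union> map (\<lambda>x. x + 2) ` odd_partitions a (Suc b)"
  moreover have "1 \<le> x" if "odd x" for x :: nat
    using that by presburger
  ultimately show "p \<in> odd_partitions (Suc a) (Suc b)"
    by (elim UnE imageE) (fastforce simp: odd_partitions_def sorted_wrt_append sorted_wrt_map)+
qed

lemma gen_fun_odd_partitions_split_max:
  "gen_fun (odd_partitions (Suc a) (Suc b)) =
     gen_fun (odd_partitions a (Suc b)) + monom 1 (2 * a + 3) * gen_fun (odd_partitions (Suc a) b)"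
proof -
  have "gen_fun (Cons (2 * a + 3) ` odd_partitions (Suc a) b) =
      monom 1 (2 * a + 3) * gen_fun (odd_partitions (Suc a) b)"
    by (rule gen_fun_image) auto
  moreover have "odd_partitions a (Suc b) \<inter> Cons (2 * a + 3) ` odd_partitions (Suc a) b = {}"
  proof -
    have "2 * a + 3 \<notin> set p" if "p \<in> odd_partitions a (Suc b)" for p
    proof
      assume "2 * a + 3 \<in> set p"
      with that have "2 * a + 3 \<le> 2 * a + 1" unfolding odd_partitions_def by blast
      then show False by simp
    qed
    then show ?thesis by (metis (no_types, lifting) disjoint_iff imageE list.set_intros(1))
  qed
  ultimately show ?thesis
    by (simp add: odd_partitions_split_max gen_fun_Un_disjoint)
qed

lemma gen_fun_odd_partitions_split_min:
  "gen_fun (odd_partitions (Suc a) (Suc b)) =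
     monom 1 1 * gen_fun (odd_partitions (Suc a) b)
     + monom 1 (2 * Suc b) * gen_fun (odd_partitions a (Suc b))"
proof -
  have 1: "gen_fun ((\<lambda>p. p @ [1]) ` odd_partitions (Suc a) b) =
      monom 1 1 * gen_fun (odd_partitions (Suc a) b)"
    by (rule gen_fun_image) (auto simp: inj_on_def)
  have 2: "gen_fun (map (\<lambda>x. x + 2) ` odd_partitions a (Suc b)) =
      monom 1 (2 * Suc b) * gen_fun (odd_partitions a (Suc b))"
  proof (rule gen_fun_image)
    show "inj_on (map (\<lambda>x. x + 2)) (odd_partitions a (Suc b))"
      by (intro inj_on_subset[OF inj_mapI] injI) auto
    show "sum_list (map (\<lambda>x. x + 2) p) = 2 * Suc b + sum_list p"
      if "p \<in> odd_partitions a (Suc b)" for p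
    proof -
      have "sum_list (map (\<lambda>x. x + 2) p) = 2 * length p + sum_list p"
        by (induction p) auto
      moreover have "length p = Suc b" using that unfolding odd_partitions_def by blast
      ultimately show ?thesis by simp
    qed
  qed
  \<comment> \<open>The part 1 tells the two images apart.\<close>
  have "1 \<notin> set (map (\<lambda>x. x + 2) r)" for r :: "nat list"
    by auto
  then have "(\<lambda>p. p @ [1]) ` odd_partitions (Suc a) b
      \<inter> map (\<lambda>x. x + 2) ` odd_partitions a (Suc b) = {}"
    by (metis (no_types, lifting) disjoint_iff imageE in_set_conv_decomp)
  then show ?thesis
    unfolding odd_partitions_split_min 1[symmetric] 2[symmetric]
    by (rule gen_fun_Un_disjoint[rotated 2]) (intro finite_imageI finite_odd_partitions)+
qed

text \<open>In the double induction, the smallest-part recurrence on the left matches the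
  largest-part recurrence on the right term by term.\<close>

lemma gen_fun_odd_partitions_sym:
  "monom 1 b * gen_fun (odd_partitions b a) = monom 1 a * gen_fun (odd_partitions a b)"
proof (induction a arbitrary: b)
  case 0
  show ?case by (simp add: mult_monom)
next
  case (Suc a)
  note IH_a = Suc.IH
  show ?case
  proof (induction b)
    case 0
    show ?case by (simp add: mult_monom)
  next
    case (Suc b)
    \<comment> \<open>The powers are regrouped so that the first bracket fits the outer induction
      hypothesis at \<open>Suc b\<close> and the second fits the inner one.\<close>
    have "monom 1 (Suc b) * gen_fun (odd_partitions (Suc b) (Suc a)) =
        monom 1 1 * (monom 1 (Suc b) * gen_fun (odd_partitions (Suc b) a))
        + monom 1 (2 * a + 3) * (monom 1 b * gen_fun (odd_partitions b (Suc a)))"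
      unfolding gen_fun_odd_partitions_split_min
      by (simp add: distrib_left mult_monom numeral_3_eq_3 add_ac flip: mult.assoc)
    also have "\<dots> = monom 1 (Suc a) * gen_fun (odd_partitions (Suc a) (Suc b))"
      unfolding IH_a Suc.IH gen_fun_odd_partitions_split_max
      by (simp add: distrib_left mult_monom add_ac flip: mult.assoc)
    finally show ?case .
  qed
qed

section \<open>Partitions into distinct parts\<close>

lemma alt_sum_Nil [simp]: "alt_sum [] = 0"
  by (simp add: alt_sum_def)

lemma alt_sum_Cons [simp]: "alt_sum (x # p) = int x - alt_sum p"
  by (simp add: alt_sum_def lessThan_Suc_eq_insert_0 sum.reindex sum_negf del: sum.lessThan_Suc)

text \<open>\<open>k\<close> is an integer because the recurrence passes to
  \<open>int (Suc N) - k\<close>, which may be negative.\<close>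

definition distinct_partitions :: "nat \<Rightarrow> int \<Rightarrow> nat list set" where
  "distinct_partitions N k = {p. sorted_wrt (>) p \<and> set p \<subseteq> {0<..N} \<and> alt_sum p = k}"

lemma distinct_partitions_0: "distinct_partitions 0 k = (if k = 0 then {[]} else {})"
  by (auto simp: distinct_partitions_def)

lemma distinct_partitions_Suc:
  "distinct_partitions (Suc N) k =
     distinct_partitions N k \<union> Cons (Suc N) ` distinct_partitions N (int (Suc N) - k)"
proof (intro equalityI subsetI)
  fix p assume p: "p \<in> distinct_partitions (Suc N) k"
  show "p \<in> distinct_partitions N k \<union> Cons (Suc N) ` distinct_partitions N (int (Suc N) - k)"
  proof (cases p)
    case Nil
    then show ?thesis using p by (auto simp: distinct_partitions_def)
  next
    case (Cons x r)
    show ?thesis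
    proof (cases "x = Suc N")
      case True
      then show ?thesis using p Cons by (fastforce simp: distinct_partitions_def)
    next
      case False
      then have "p \<in> distinct_partitions N k"
        using p Cons by (fastforce simp: distinct_partitions_def)
      then show ?thesis by blast
    qed
  qed
qed (fastforce simp: distinct_partitions_def)

lemma finite_distinct_partitions [simp]: "finite (distinct_partitions N k)"
  by (induction N arbitrary: k) (auto simp: distinct_partitions_0 distinct_partitions_Suc)

text \<open>The reflection of \<open>k\<close> to \<open>int (Suc N) - k\<close> swaps the two ways
  of being out of range, so the induction closes. This settles the boundary cases below.\<close>

lemma distinct_partitions_empty: "k < 0 \<or> int N < k \<Longrightarrow> distinct_partitions N k = {}"
  by (induction N arbitrary: k) (auto simp: distinct_partitions_0 distinct_partitions_Suc)

lemma gen_fun_distinct_partitions_Suc: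
  "gen_fun (distinct_partitions (Suc N) k) =
     gen_fun (distinct_partitions N k)
     + monom 1 (Suc N) * gen_fun (distinct_partitions N (int (Suc N) - k))"
proof -
  have "gen_fun (Cons (Suc N) ` distinct_partitions N (int (Suc N) - k)) =
      monom 1 (Suc N) * gen_fun (distinct_partitions N (int (Suc N) - k))"
    by (rule gen_fun_image) auto
  moreover have "distinct_partitions N k
      \<inter> Cons (Suc N) ` distinct_partitions N (int (Suc N) - k) = {}"
  proof -
    have "Suc N \<notin> set p" if "p \<in> distinct_partitions N k" for p
      using that unfolding distinct_partitions_def by fastforce
    then show ?thesis by (metis (no_types, lifting) disjoint_iff imageE list.set_intros(1))
  qed
  ultimately show ?thesis
    unfolding distinct_partitions_Suc
    by (simp only: gen_fun_Un_disjoint finite_imageI finite_distinct_partitions)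
qed

text \<open>The induction runs over the sum \<open>a + b\<close> with both summands free, since the
  recurrence for distinct parts exchanges their roles.\<close>

lemma gen_fun_distinct_eq_odd:
  "gen_fun (distinct_partitions (a + b) (int b)) = gen_fun (odd_partitions a b)"
proof (induction "a + b" arbitrary: a b)
  case 0
  then show ?case by (simp add: distinct_partitions_0)
next
  case (Suc N)
  note step = gen_fun_distinct_partitions_Suc[of N "int b", unfolded Suc.hyps(2)]
  consider "b = 0" | "a = 0" | a' b' where "a = Suc a'" "b = Suc b'"
    by (metis not0_implies_Suc)
  then show ?case
  proof cases
    \<comment> \<open>The second summand asks for alternating sum \<open>Suc N\<close> from parts at
      most \<open>N\<close>, so it vanishes.\<close>
    case 1
    then have "gen_fun (distinct_partitions N 0) = gen_fun (odd_partitions N 0)"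
      using Suc.hyps(1)[of N 0] by simp
    moreover have "a = Suc N" using 1 Suc.hyps(2) by simp
    ultimately show ?thesis using 1 step by (simp add: distinct_partitions_empty)
  next
    \<comment> \<open>Here the first summand vanishes, and the second reduces to alternating sum
      0.\<close>
    case 2
    then have "b = Suc N" using Suc.hyps(2) by simp
    moreover have "gen_fun (distinct_partitions N 0) = gen_fun (odd_partitions N 0)"
      using Suc.hyps(1)[of N 0] by simp
    ultimately show ?thesis using 2 step
      by (simp add: distinct_partitions_empty mult_monom)
  next
    case 3
    have N: "N = a' + Suc b'" "N = b' + Suc a'" using 3 Suc.hyps(2) by auto
    have k: "int (Suc N) - int b = int (Suc a')" using 3 N by simp
    have "gen_fun (distinct_partitions (a + b) (int b)) =
        gen_fun (odd_partitions a' b) + monom 1 (Suc N) * gen_fun (odd_partitions b' (Suc a'))"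
      unfolding step k using Suc.hyps(1)[OF N(1)] Suc.hyps(1)[OF N(2)] N 3
      by (simp add: add_ac)
    also have "monom 1 (Suc N) * gen_fun (odd_partitions b' (Suc a')) =
        monom 1 (a' + 2) * (monom 1 b' * gen_fun (odd_partitions b' (Suc a')))"
      using N by (simp add: mult_monom add_ac flip: mult.assoc)
    also have "\<dots> = monom 1 (2 * a' + 3) * gen_fun (odd_partitions (Suc a') b')"
      by (subst gen_fun_odd_partitions_sym)
        (simp add: mult_monom numeral_3_eq_3 mult_2 flip: mult.assoc)
    finally show ?thesis
      using 3 by (simp add: gen_fun_odd_partitions_split_max)
  qed
qed

theorem theorem5p5:
  fixes N n k :: nat
  shows "card {p \<in> partitions_of n. length p = k \<and>
             (\<forall>x\<in>set p. odd x \<and> int x \<le> 2 * int N - 2 * int k + 1)}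
       = card {p \<in> partitions_of n. distinct p \<and> (\<forall>x\<in>set p. x \<le> N) \<and> alt_sum p = int k}"
    (is "card ?O = card ?D")
proof -
  have strict: "sorted_wrt (>) p \<longleftrightarrow> sorted_wrt (\<ge>) p \<and> distinct p" for p :: "nat list"
    by (induction p) (auto simp: order.strict_iff_order)
  have D: "?D = {p \<in> distinct_partitions N (int k). sum_list p = n}"
    by (auto simp: partitions_of_def is_partition_def distinct_partitions_def strict)
  show ?thesis
  proof (cases "k \<le> N")
    case True
    have "int x \<le> 2 * int N - 2 * int k + 1 \<longleftrightarrow> x \<le> 2 * (N - k) + 1" for x
      using True by linarith
    then have "?O = {p \<in> odd_partitions (N - k) k. sum_list p = n}"
      by (auto simp: partitions_of_def is_partition_def odd_partitions_def odd_pos)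
    then show ?thesis
      using True D gen_fun_distinct_eq_odd[of "N - k" k]
      by (simp flip: coeff_gen_fun)
  next
    case False
    then have "\<not> int x \<le> 2 * int N - 2 * int k + 1" for x
      by linarith
    moreover have "p \<noteq> []" if "length p = k" for p :: "nat list"
      using that False by auto
    ultimately have "?O = {}"
      by (auto simp del: set_empty simp flip: set_empty)
    moreover have "?D = {}"
      unfolding D using False by (simp add: distinct_partitions_empty)
    ultimately show ?thesis by (simp only:)
  qed
qed

end
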